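(* Let $r\ge 2$ be an integer. Then there exists a radical ideal of points $I$ in $\mathbb{K}[\mathbb{P}^2]$ that satisfies the necessary condition for the failure of the containment $I^{(2r-1)}\subseteq I^r$, i.e., such that $\rho(I)\ge \frac{2r-1}{r}$.
   Context: $\mathbb{K}$ is an algebraically closed field and $R=\mathbb{K}[\mathbb{P}^2]=\mathbb{K}[x_0,x_1,x_2]$ is the coordinate ring of the projective plane over $\mathbb{K}$. A radical ideal of points is the homogeneous ideal generated by all forms vanishing at every point of some finite set of points $p_1,\dots,p_n\in\mathbb{P}^2$. For a positive integer $m$, the symbolic power of such an ideal $I$ is $I^{(m)}=\bigcap_i I(p_i)^m$, where $I(p_i)$ is the ideal of the point $p_i$ (equivalently $I^{(m)}=R\cap I^mR_U$ with $U=R-\bigcup_{P\in\mathrm{Ass}(I)}P$). $I^r$ is the ordinary power. The resurgence is $\rho(I)=\sup\{\frac{m}{s}\mid m,s\text{ positive integers},\ I^{(m)}\nsubseteq I^s\}$. The "necessary condition for the failure of $I^{(2r-1)}\subseteq I^r$" means precisely the inequality $\rho(I)\ge\frac{2r-1}{r}$. *)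

theory Defs
  imports
    "HOL-Library.Poly_Mapping"
    "HOL-Library.Numeral_Type"
    "HOL-Library.Extended_Real"
    "HOL-Computational_Algebra.Polynomial"
    "HOL-Analysis.Finite_Cartesian_Product"
begin

text \<open>
  The index type \<^typ>\<open>3\<close> has exactly the elements 0, 1, 2. A polynomial in $x_0, x_1, x_2$
  is a finitely supported map from exponent vectors to coefficients; Poly-Mapping equips this
  type with the convolution product, which makes it the usual polynomial ring.
\<close>
type_synonym 'k ternary_poly = "(3 \<Rightarrow>\<^sub>0 nat) \<Rightarrow>\<^sub>0 'k"

definition eval_poly :: "'k::comm_ring_1 ternary_poly \<Rightarrow> 'k ^ 3 \<Rightarrow> 'k" where
  "eval_poly f a = (\<Sum>t\<in>Poly_Mapping.keys f. Poly_Mapping.lookup f t * (\<Prod>i\<in>UNIV. (a $ i) ^ Poly_Mapping.lookup t i))"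

definition form_of_degree :: "nat \<Rightarrow> 'k::zero ternary_poly \<Rightarrow> bool" where
  "form_of_degree d f \<longleftrightarrow> (\<forall>t\<in>Poly_Mapping.keys f. (\<Sum>i\<in>UNIV. Poly_Mapping.lookup t i) = d)"

text \<open>A point of the projective plane is the set of all its homogeneous coordinate vectors.\<close>
definition proj_point :: "'k::field ^ 3 \<Rightarrow> ('k ^ 3) set" where
  "proj_point v = {c *s v | c. c \<noteq> 0}"

definition proj_plane :: "('k::field ^ 3) set set" where
  "proj_plane = {proj_point v | v. v \<noteq> 0}"

definition vanishes_at :: "'k::field ternary_poly \<Rightarrow> ('k ^ 3) set \<Rightarrow> bool" where
  "vanishes_at f p \<longleftrightarrow> (\<forall>a\<in>p. eval_poly f a = 0)"

text \<open>
  A commutative ring as a module over itself: \<open>ideal.subspace\<close> is the predicate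
  ``is an ideal'' and \<open>ideal.span S\<close> is the ideal generated by \<open>S\<close>.
\<close>
global_interpretation ideal: module "(*) :: 'a::comm_ring_1 \<Rightarrow> 'a \<Rightarrow> 'a"
  by unfold_locales (simp_all add: algebra_simps)

definition ideal_mult :: "'a::comm_ring_1 set \<Rightarrow> 'a set \<Rightarrow> 'a set" where
  "ideal_mult I J = ideal.span {f * g | f g. f \<in> I \<and> g \<in> J}"

primrec ideal_power :: "'a::comm_ring_1 set \<Rightarrow> nat \<Rightarrow> 'a set" where
  "ideal_power I 0 = UNIV"
| "ideal_power I (Suc n) = ideal_mult I (ideal_power I n)"

definition ideal_of_points :: "('k::field ^ 3) set set \<Rightarrow> 'k ternary_poly set" where
  "ideal_of_points Z = ideal.span {f. (\<exists>d. form_of_degree d f) \<and> (\<forall>p\<in>Z. vanishes_at f p)}"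

definition radical_ideal_of_points :: "'k::field ternary_poly set \<Rightarrow> bool" where
  "radical_ideal_of_points I \<longleftrightarrow>
     (\<exists>Z. finite Z \<and> Z \<noteq> {} \<and> Z \<subseteq> proj_plane \<and> I = ideal_of_points Z)"

definition zero_locus :: "'k::field ternary_poly set \<Rightarrow> ('k ^ 3) set set" where
  "zero_locus I = {p \<in> proj_plane. \<forall>f\<in>I. vanishes_at f p}"

text \<open>
  Meant for radical ideals of points. Such an ideal determines its points: they are its zero locus
  (lemma \<open>zero_locus_ideal_of_points\<close>). So for the ideal of $p_1, \dots, p_n$
  this is $\bigcap_i I(p_i)^m$ (lemma \<open>symbolic_power_ideal_of_points\<close>).
\<close>
definition symbolic_power :: "'k::field ternary_poly set \<Rightarrow> nat \<Rightarrow> 'k ternary_poly set" where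
  "symbolic_power I m = (\<Inter>p\<in>zero_locus I. ideal_power (ideal_of_points {p}) m)"

text \<open>The supremum is taken in the extended reals, so no boundedness is presupposed.\<close>
definition resurgence :: "'k::field ternary_poly set \<Rightarrow> ereal" where
  "resurgence I = Sup {ereal (real m / real s) | m s.
     m > 0 \<and> s > 0 \<and> \<not> symbolic_power I m \<subseteq> ideal_power I s}"


lemma eval_poly_superset:
  assumes "finite A" "Poly_Mapping.keys f \<subseteq> A"
  shows "eval_poly f a = (\<Sum>t\<in>A. Poly_Mapping.lookup f t * (\<Prod>i\<in>UNIV. (a $ i) ^ Poly_Mapping.lookup t i))"
  unfolding eval_poly_def
  by (rule sum.mono_neutral_left) (use assms in \<open>auto simp: in_keys_iff\<close>)

lemma eval_poly_zero [simp]: "eval_poly 0 a = 0"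
  by (simp add: eval_poly_def)

lemma eval_poly_add: "eval_poly (f + g) a = eval_poly f a + eval_poly g a"
proof -
  let ?A = "Poly_Mapping.keys f \<union> Poly_Mapping.keys g"
  have "Poly_Mapping.keys (f + g) \<subseteq> ?A"
    by (rule Poly_Mapping.keys_add)
  then show ?thesis
    by (simp add: eval_poly_superset[where A = ?A] Poly_Mapping.lookup_add distrib_right
      sum.distrib)
qed

lemma eval_poly_sum: "eval_poly (sum F A) a = (\<Sum>x\<in>A. eval_poly (F x) a)"
  by (induction A rule: infinite_finite_induct) (simp_all add: eval_poly_add)

lemma eval_poly_single:
  "eval_poly (Poly_Mapping.single t c) a = c * (\<Prod>i\<in>UNIV. (a $ i) ^ Poly_Mapping.lookup t i)"
  by (subst eval_poly_superset[where A = "{t}"]) auto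

lemma poly_mapping_sum_single:
  fixes f :: "'a \<Rightarrow>\<^sub>0 'b::comm_monoid_add"
  shows "(\<Sum>t\<in>Poly_Mapping.keys f. Poly_Mapping.single t (Poly_Mapping.lookup f t)) = f"
proof (rule poly_mapping_eqI)
  fix k
  show "Poly_Mapping.lookup (\<Sum>t\<in>Poly_Mapping.keys f. Poly_Mapping.single t (Poly_Mapping.lookup f t)) k = Poly_Mapping.lookup f k"
    by (simp add: lookup_sum lookup_single when_def not_in_keys_iff_lookup_eq_zero)
qed

lemma eval_poly_mult: "eval_poly (f * g) a = eval_poly f a * eval_poly g a"
proof -
  let ?F = "Poly_Mapping.keys f" and ?G = "Poly_Mapping.keys g"
  let ?m = "\<lambda>t. \<Prod>i\<in>UNIV. (a $ i) ^ Poly_Mapping.lookup t i"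
  have "f * g = (\<Sum>s\<in>?F. Poly_Mapping.single s (Poly_Mapping.lookup f s))
      * (\<Sum>t\<in>?G. Poly_Mapping.single t (Poly_Mapping.lookup g t))"
    unfolding poly_mapping_sum_single by (rule refl)
  also have "\<dots> = (\<Sum>s\<in>?F. \<Sum>t\<in>?G.
      Poly_Mapping.single (s + t) (Poly_Mapping.lookup f s * Poly_Mapping.lookup g t))"
    unfolding sum_product mult_single by (rule refl)
  finally have fg: "f * g = \<dots>" .
  have "eval_poly (f * g) a = (\<Sum>s\<in>?F. \<Sum>t\<in>?G.
      Poly_Mapping.lookup f s * Poly_Mapping.lookup g t * ?m (s + t))"
    unfolding fg eval_poly_sum eval_poly_single by (rule refl)
  also have "\<dots> = (\<Sum>s\<in>?F. \<Sum>t\<in>?G.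
      (Poly_Mapping.lookup f s * ?m s) * (Poly_Mapping.lookup g t * ?m t))"
    by (intro sum.cong refl)
      (simp only: Poly_Mapping.lookup_add power_add prod.distrib mult.assoc mult.left_commute)
  also have "\<dots> = eval_poly f a * eval_poly g a"
    unfolding eval_poly_def sum_product by (rule refl)
  finally show ?thesis .
qed

lemma eval_poly_one [simp]: "eval_poly 1 a = 1"
  using eval_poly_single[of 0 1 a] by simp

lemma eval_poly_prod: "eval_poly (prod F A) a = (\<Prod>x\<in>A. eval_poly (F x) a)"
  by (induction A rule: infinite_finite_induct) (simp_all add: eval_poly_mult)

lemma form_of_degree_mult:
  assumes "form_of_degree d f" "form_of_degree e g"
  shows "form_of_degree (d + e) (f * g)"
  unfolding form_of_degree_def
proof
  fix t assume "t \<in> Poly_Mapping.keys (f * g)"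
  then obtain u v where "u \<in> Poly_Mapping.keys f" "v \<in> Poly_Mapping.keys g" "t = u + v"
    using Poly_Mapping.keys_mult[of f g] by blast
  then show "(\<Sum>i\<in>UNIV. Poly_Mapping.lookup t i) = d + e"
    using assms by (simp add: form_of_degree_def Poly_Mapping.lookup_add sum.distrib)
qed

lemma form_of_degree_prod:
  assumes "\<And>x. x \<in> A \<Longrightarrow> form_of_degree (d x) (F x :: 'k::comm_ring_1 ternary_poly)"
  shows "form_of_degree (sum d A) (prod F A)"
  using assms
proof (induction A rule: infinite_finite_induct)
  case (insert x A)
  then show ?case by (simp add: form_of_degree_mult)
qed (simp_all add: form_of_degree_def)

lemma ideal_of_points_vanishes:
  assumes "f \<in> ideal_of_points Z" "p \<in> Z"
  shows "vanishes_at f p"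
  using assms(1) unfolding ideal_of_points_def
proof (induction rule: ideal.span_induct_alt)
  case base
  then show ?case by (simp add: vanishes_at_def)
next
  case (step c x y)
  then show ?case using assms(2) by (simp add: vanishes_at_def eval_poly_add eval_poly_mult)
qed

lemma separating_linear_form:
  fixes v w :: "'k::field ^ 3"
  assumes "v \<noteq> 0" "w \<noteq> 0" "proj_point v \<noteq> proj_point w"
  shows "\<exists>l. form_of_degree 1 l \<and> vanishes_at l (proj_point w) \<and> eval_poly l v \<noteq> 0"
proof -
  define L :: "3 \<Rightarrow> 3 \<Rightarrow> 'k ternary_poly" where
    "L i j = Poly_Mapping.single (Poly_Mapping.single j 1) (w $ i)
           + Poly_Mapping.single (Poly_Mapping.single i 1) (- w $ j)" for i j
  have mon: "(\<Prod>k\<in>UNIV. (a $ k) ^ Poly_Mapping.lookup (Poly_Mapping.single i (1::nat)) k) = a $ i"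
    for a :: "'k ^ 3" and i :: 3
  proof -
    have "(\<Prod>k\<in>UNIV. (a $ k) ^ Poly_Mapping.lookup (Poly_Mapping.single i (1::nat)) k)
        = (\<Prod>k\<in>UNIV. if k = i then a $ k else 1)"
      by (rule prod.cong) (auto simp: lookup_single when_def)
    then show ?thesis by simp
  qed
  have ev: "eval_poly (L i j) a = w $ i * a $ j - w $ j * a $ i" for i j a
    unfolding L_def eval_poly_add eval_poly_single mon by simp
  have hom: "form_of_degree 1 (L i j)" for i j
  proof -
    have "(\<Sum>k\<in>UNIV. Poly_Mapping.lookup (Poly_Mapping.single i (1::nat)) k) = 1" for i :: 3
      by (simp add: lookup_single when_def)
    moreover have "Poly_Mapping.keys (L i j)
        \<subseteq> {Poly_Mapping.single j 1, Poly_Mapping.single i 1}"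
      unfolding L_def by (rule order_trans[OF Poly_Mapping.keys_add]) auto
    ultimately show ?thesis by (auto simp: form_of_degree_def)
  qed
  have van: "vanishes_at (L i j) (proj_point w)" for i j
    by (auto simp: vanishes_at_def proj_point_def ev)
  obtain i where i: "w $ i \<noteq> 0"
    using assms(2) by (metis vec_eq_iff zero_index)
  have "\<exists>j. eval_poly (L i j) v \<noteq> 0"
  proof (rule ccontr)
    assume "\<not> ?thesis"
    then have *: "w $ i * v $ j = w $ j * v $ i" for j
      by (simp add: ev)
    define c where "c = v $ i / w $ i"
    have v: "v = c *s w"
      unfolding vec_eq_iff c_def using * i by (simp add: field_simps)
    then have c: "c \<noteq> 0" using assms(1) by auto
    have "proj_point v = proj_point w"
    proof
      show "proj_point v \<subseteq> proj_point w"
      proof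
        fix x assume "x \<in> proj_point v"
        then obtain d where "d \<noteq> 0" "x = d *s v" by (auto simp: proj_point_def)
        then have "x = (d * c) *s w" "d * c \<noteq> 0" using v c by (auto simp: vec_eq_iff)
        then show "x \<in> proj_point w" unfolding proj_point_def by blast
      qed
      show "proj_point w \<subseteq> proj_point v"
      proof
        fix x assume "x \<in> proj_point w"
        then obtain d where "d \<noteq> 0" "x = d *s w" by (auto simp: proj_point_def)
        then have "x = (d / c) *s v" "d / c \<noteq> 0" using v c by (auto simp: vec_eq_iff)
        then show "x \<in> proj_point v" unfolding proj_point_def by blast
      qed
    qed
    with assms(3) show False by simp
  qed
  with hom van show ?thesis by blast
qed

lemma zero_locus_ideal_of_points:
  assumes "finite Z" "Z \<subseteq> proj_plane"
  shows "zero_locus (ideal_of_points Z) = Z"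
proof
  show "Z \<subseteq> zero_locus (ideal_of_points Z)"
    using assms(2) ideal_of_points_vanishes by (auto simp: zero_locus_def)
next
  show "zero_locus (ideal_of_points Z) \<subseteq> Z"
  proof (rule subsetI, rule ccontr)
    fix p assume p: "p \<in> zero_locus (ideal_of_points Z)" and "p \<notin> Z"
    then obtain v where v: "v \<noteq> 0" "p = proj_point v"
      by (auto simp: zero_locus_def proj_plane_def)
    have vp: "v \<in> p"
      unfolding v proj_point_def by (intro CollectI exI[of _ 1]) simp
    have "\<exists>l. form_of_degree 1 l \<and> vanishes_at l q \<and> eval_poly l v \<noteq> 0" if q: "q \<in> Z" for q
    proof -
      obtain w where "w \<noteq> 0" "q = proj_point w"
        using assms(2) q by (auto simp: proj_plane_def)
      moreover have "proj_point v \<noteq> q" using q \<open>p \<notin> Z\<close> v by auto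
      ultimately show ?thesis using separating_linear_form v(1) by blast
    qed
    then obtain l where l: "\<And>q. q \<in> Z \<Longrightarrow>
        form_of_degree 1 (l q) \<and> vanishes_at (l q) q \<and> eval_poly (l q) v \<noteq> 0"
      by metis
    have "form_of_degree (\<Sum>q\<in>Z. 1) (prod l Z)"
      using l by (intro form_of_degree_prod) auto
    moreover have "vanishes_at (prod l Z) q" if "q \<in> Z" for q
      using l[OF that] that assms(1) by (auto simp: vanishes_at_def eval_poly_prod)
    ultimately have "prod l Z \<in> ideal_of_points Z"
      unfolding ideal_of_points_def by (intro ideal.span_base) blast
    then have "eval_poly (prod l Z) v = 0"
      using p vp by (auto simp: zero_locus_def vanishes_at_def)
    then show False using l assms(1) by (auto simp: eval_poly_prod)
  qed
qed

lemma symbolic_power_ideal_of_points: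
  assumes "finite Z" "Z \<subseteq> proj_plane"
  shows "symbolic_power (ideal_of_points Z) m = (\<Inter>p\<in>Z. ideal_power (ideal_of_points {p}) m)"
  by (simp add: symbolic_power_def zero_locus_ideal_of_points[OF assms])

end

theory Submission
  imports Defs "HOL-Analysis.Cartesian_Space"
begin

text \<open>
  The ideal is that of a star configuration: the \<open>d choose 2\<close> points in which \<open>d = 2r\<close> lines, no
  three of them through one point, meet pairwise. Let \<open>F\<close> be the product of the \<open>d\<close> linear forms.
  Two of the lines pass through each point, so \<open>F\<close> is in the symbolic square of \<open>I\<close>, and
  \<open>F ^ t\<close>, a form of degree \<open>d * t\<close>, is in the symbolic power of exponent \<open>2 * t\<close>
  (lemma \<open>power_prod_line_form_in_symbolic_power\<close>). On the other hand each line carries \<open>d - 1\<close>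
  of the points. So a form of degree below \<open>d - 1\<close> that vanishes at all the points vanishes on all
  the lines; any point is on a line that meets the \<open>d\<close> lines in enough points to conclude that the
  form vanishes there too. Hence nonzero elements of \<open>I\<close> start in degree at least \<open>d - 1\<close>, those
  of \<open>I ^ s\<close> start in degree at least \<open>s * (d - 1)\<close>, and \<open>F ^ t\<close> is outside \<open>I ^ s\<close> as soon as
  \<open>d * t < s * (d - 1)\<close>. The ratios \<open>2 * t / s\<close> subject to this inequality come
  arbitrarily close to \<open>2 * (d - 1) / d\<close>, which is \<open>(2 * r - 1) / r\<close>.

  To have a configuration in every characteristic, view the plane as the space of nonzero
  quadratic polynomials \<open>v\<^sub>1 + v\<^sub>2 X + v\<^sub>3 X\<^sup>2\<close> up to scalars. The quadratics with a prescribed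
  root \<open>a\<close> form a line, the lines of \<open>a \<noteq> b\<close> meet in the quadratic with roots \<open>a\<close> and \<open>b\<close>, and
  a nonzero quadratic has no third root. So any \<open>d\<close> distinct field elements define a star
  configuration.
\<close>

section \<open>Powers of ideals\<close>

lemma subspace_ideal_power: "ideal.subspace (ideal_power I n)"
  by (cases n) (simp_all add: ideal_mult_def)

lemma mult_in_ideal_power_Suc:
  assumes "f \<in> I" "g \<in> ideal_power I n"
  shows "f * g \<in> ideal_power I (Suc n)"
  using assms by (auto simp: ideal_mult_def intro!: ideal.span_base)

lemma power_mult_in_ideal_power:
  assumes "f \<in> I" "g \<in> I"
  shows "(f * g * h) ^ t \<in> ideal_power I (2 * t)"
proof (induction t)
  case (Suc t)
  have "f * (g * (f * g * h) ^ t) \<in> ideal_power I (Suc (Suc (2 * t)))"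
    using assms Suc by (intro mult_in_ideal_power_Suc)
  then have "h * (f * (g * (f * g * h) ^ t)) \<in> ideal_power I (Suc (Suc (2 * t)))"
    by (rule ideal.subspace_scale[OF subspace_ideal_power])
  also have "h * (f * (g * (f * g * h) ^ t)) = (f * g * h) ^ Suc t"
    by (simp only: power_Suc mult.assoc mult.left_commute[of h])
  finally show ?case by simp
qed simp

section \<open>Restriction of ternary polynomials to lines\<close>

lemma eval_poly_on_line:
  fixes f :: "'k::field ternary_poly"
  obtains q where "\<And>x. poly q x = eval_poly f (u + x *s w)"
    and "\<And>e. form_of_degree e f \<Longrightarrow> degree q \<le> e"
proof
  define q where "q = (\<Sum>t\<in>Poly_Mapping.keys f.
    smult (Poly_Mapping.lookup f t) (\<Prod>i\<in>UNIV. [:u $ i, w $ i:] ^ Poly_Mapping.lookup t i))"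
  show "poly q x = eval_poly f (u + x *s w)" for x
    by (simp add: q_def eval_poly_def poly_sum poly_prod)
  show "degree q \<le> e" if "form_of_degree e f" for e
    unfolding q_def
  proof (rule degree_sum_le)
    fix t assume t: "t \<in> Poly_Mapping.keys f"
    have "degree (\<Prod>i\<in>UNIV. [:u $ i, w $ i:] ^ Poly_Mapping.lookup t i)
        \<le> (\<Sum>i\<in>UNIV. degree ([:u $ i, w $ i:] ^ Poly_Mapping.lookup t i))"
      using degree_prod_sum_le[of UNIV "\<lambda>i. [:u $ i, w $ i:] ^ Poly_Mapping.lookup t i"]
      by (simp add: o_def)
    also have "\<dots> \<le> (\<Sum>i\<in>UNIV. Poly_Mapping.lookup t i)"
      by (intro sum_mono order_trans[OF degree_power_le]) simp
    also have "\<dots> = e" using that t by (simp add: form_of_degree_def)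
    finally show "degree (smult (Poly_Mapping.lookup f t)
        (\<Prod>i\<in>UNIV. [:u $ i, w $ i:] ^ Poly_Mapping.lookup t i)) \<le> e"
      using degree_smult_le le_trans by blast
  qed simp
qed

lemma eval_poly_form_scale:
  fixes f :: "'k::field ternary_poly"
  assumes "form_of_degree e f"
  shows "eval_poly f (x *s v) = x ^ e * eval_poly f v"
  unfolding eval_poly_def sum_distrib_left
proof (rule sum.cong)
  fix t assume "t \<in> Poly_Mapping.keys f"
  then have "(\<Prod>i\<in>UNIV. x ^ Poly_Mapping.lookup t i) = x ^ e"
    using assms by (simp add: form_of_degree_def flip: power_sum)
  then show "Poly_Mapping.lookup f t * (\<Prod>i\<in>UNIV. ((x *s v) $ i) ^ Poly_Mapping.lookup t i)
      = x ^ e * (Poly_Mapping.lookup f t * (\<Prod>i\<in>UNIV. (v $ i) ^ Poly_Mapping.lookup t i))"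
    by (simp add: power_mult_distrib prod.distrib)
qed simp

section \<open>Order of vanishing at the origin along a line\<close>

text \<open>
  This ideal bounds the degree in which the elements of a power of \<open>I\<close> start. Fixing
  one direction \<open>v\<close> keeps the argument within univariate polynomials, and loses
  nothing if \<open>v\<close> avoids the zeros of the form whose membership is in question.
\<close>
definition order_ideal :: "'k::field ^ 3 \<Rightarrow> nat \<Rightarrow> 'k ternary_poly set" where
  "order_ideal v k = {f. \<exists>q. \<forall>x. eval_poly f (x *s v) = x ^ k * poly q x}"

lemma order_idealI:
  "(\<And>x. eval_poly f (x *s v) = x ^ k * poly q x) \<Longrightarrow> f \<in> order_ideal v k"
  by (auto simp: order_ideal_def)

lemma order_ideal_0: "order_ideal v 0 = UNIV"
proof -
  have "f \<in> order_ideal v 0" for f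
  proof -
    obtain q where "\<And>x. poly q x = eval_poly f (0 + x *s v)"
      by (rule eval_poly_on_line[of f 0 v]) (rule that)
    then show ?thesis by (intro order_idealI[where q = q]) simp
  qed
  then show ?thesis by auto
qed

lemma order_ideal_mult:
  assumes "f \<in> order_ideal v j" "g \<in> order_ideal v k"
  shows "f * g \<in> order_ideal v (j + k)"
proof -
  obtain p q where pq: "\<And>x. eval_poly f (x *s v) = x ^ j * poly p x"
    "\<And>x. eval_poly g (x *s v) = x ^ k * poly q x"
    using assms unfolding order_ideal_def by blast
  show ?thesis
    by (rule order_idealI[where q = "p * q"])
      (simp only: eval_poly_mult pq power_add poly_mult mult.assoc mult.left_commute)
qed

lemma subspace_order_ideal: "ideal.subspace (order_ideal v k)"
proof (rule ideal.subspaceI)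
  show "0 \<in> order_ideal v k" by (rule order_idealI[where q = 0]) simp
next
  fix f g assume "f \<in> order_ideal v k" "g \<in> order_ideal v k"
  then obtain p q where pq: "\<And>x. eval_poly f (x *s v) = x ^ k * poly p x"
    "\<And>x. eval_poly g (x *s v) = x ^ k * poly q x"
    unfolding order_ideal_def by blast
  show "f + g \<in> order_ideal v k"
    by (rule order_idealI[where q = "p + q"])
      (simp only: eval_poly_add pq poly_add distrib_left)
next
  fix c f assume "f \<in> order_ideal v k"
  then show "c * f \<in> order_ideal v k"
    using order_ideal_mult[of c v 0 f k] by (simp add: order_ideal_0)
qed

lemma ideal_power_subset_order_ideal:
  assumes "I \<subseteq> order_ideal v k"
  shows "ideal_power I s \<subseteq> order_ideal v (s * k)"
proof (induction s)
  case (Suc s)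
  show ?case unfolding ideal_power.simps ideal_mult_def
  proof (rule ideal.span_minimal[OF _ subspace_order_ideal])
    show "{f * g |f g. f \<in> I \<and> g \<in> ideal_power I s} \<subseteq> order_ideal v (Suc s * k)"
      using assms Suc order_ideal_mult[of _ v k _ "s * k"] by auto
  qed
qed (simp add: order_ideal_0)

lemma form_in_order_ideal:
  fixes f :: "'k::field ternary_poly"
  assumes "form_of_degree e f" "k \<le> e \<or> eval_poly f v = 0"
  shows "f \<in> order_ideal v k"
  using assms(2)
proof
  assume k: "k \<le> e"
  show ?thesis
  proof (rule order_idealI)
    fix x :: 'k
    have "x ^ e = x ^ k * x ^ (e - k)" using k by (simp flip: power_add)
    then show "eval_poly f (x *s v) = x ^ k * poly (monom (eval_poly f v) (e - k)) x"
      by (simp add: eval_poly_form_scale[OF assms(1)] poly_monom)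
  qed
next
  assume zero: "eval_poly f v = 0"
  show ?thesis
    by (rule order_idealI[where q = 0]) (simp add: eval_poly_form_scale[OF assms(1)] zero)
qed

lemma form_in_order_idealD:
  fixes f :: "'k::field ternary_poly"
  assumes "infinite (UNIV :: 'k set)" "form_of_degree e f" "eval_poly f v \<noteq> 0"
    and "f \<in> order_ideal v k"
  shows "k \<le> e"
proof -
  obtain q where q: "\<And>x. eval_poly f (x *s v) = x ^ k * poly q x"
    using assms(4) unfolding order_ideal_def by blast
  let ?p = "monom (eval_poly f v) e - monom 1 k * q"
  have "poly ?p x = 0" for x
    using q[of x] eval_poly_form_scale[OF assms(2), of x v]
    by (simp add: poly_monom mult.commute[of "eval_poly f v"])
  then have "?p = 0"
    using poly_roots_finite[of ?p] assms(1) by auto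
  then have eq: "monom (eval_poly f v) e = monom 1 k * q" by simp
  then have "q \<noteq> 0" using assms(3) by auto
  then have "degree (monom 1 k * q) = k + degree q"
    by (subst degree_mult_eq) (simp_all add: degree_monom_eq)
  then show ?thesis using assms(3) eq by (metis degree_monom_eq le_add1)
qed

section \<open>A star configuration of lines\<close>

text \<open>The quadratic \<open>(X - s) * (X - t)\<close>, as its vector of coefficients.\<close>
definition root_point :: "'k::field \<Rightarrow> 'k \<Rightarrow> 'k ^ 3" where
  "root_point s t = vector [s * t, - (s + t), 1]"

text \<open>Evaluation of quadratics at \<open>a\<close>; its zeros are the quadratics with root \<open>a\<close>.\<close>
definition line_form :: "'k::field \<Rightarrow> 'k ternary_poly" where
  "line_form a = Poly_Mapping.single (Poly_Mapping.single 1 1) 1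
     + Poly_Mapping.single (Poly_Mapping.single 2 1) a
     + Poly_Mapping.single (Poly_Mapping.single 3 1) (a ^ 2)"

definition star_points :: "'k::field set \<Rightarrow> ('k ^ 3) set set" where
  "star_points A = {proj_point (root_point a b) | a b. a \<in> A \<and> b \<in> A \<and> a \<noteq> b}"

lemma root_point_nonzero: "root_point s t \<noteq> 0"
proof
  assume "root_point s t = 0"
  then have "root_point s t $ 3 = 0" by simp
  then show False by (simp add: root_point_def)
qed

lemma root_point_affine: "root_point s t = root_point s 0 + t *s vector [s, - 1, 0]"
  by (simp add: root_point_def vec_eq_iff forall_3)

lemma root_point_commute: "root_point s t = root_point t s"
  by (simp add: root_point_def mult.commute add.commute)

lemma eval_line_form: "eval_poly (line_form a) v = v $ 1 + a * v $ 2 + a ^ 2 * v $ 3"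
proof -
  have "(\<Prod>k\<in>UNIV. (v $ k) ^ Poly_Mapping.lookup (Poly_Mapping.single i (1::nat)) k) = v $ i"
    for i :: 3
  proof -
    have "(\<Prod>k\<in>UNIV. (v $ k) ^ Poly_Mapping.lookup (Poly_Mapping.single i (1::nat)) k)
        = (\<Prod>k\<in>UNIV. if k = i then v $ k else 1)"
      by (rule prod.cong) (auto simp: lookup_single when_def)
    then show ?thesis by simp
  qed
  then show ?thesis
    unfolding line_form_def eval_poly_add eval_poly_single by simp
qed

lemma eval_line_form_root_point:
  "eval_poly (line_form a) (root_point s t) = (a - s) * (a - t)"
  by (simp add: eval_line_form root_point_def algebra_simps power2_eq_square)

lemma form_of_degree_line_form: "form_of_degree 1 (line_form a)"
proof -
  have "(\<Sum>k\<in>UNIV. Poly_Mapping.lookup (Poly_Mapping.single i (1::nat)) k) = 1" for i :: 3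
    by (simp add: lookup_single when_def)
  moreover have "Poly_Mapping.keys (line_form a)
      \<subseteq> {Poly_Mapping.single 1 1, Poly_Mapping.single 2 1, Poly_Mapping.single 3 1}"
    unfolding line_form_def
    by (intro order_trans[OF Poly_Mapping.keys_add] Un_least) auto
  ultimately show ?thesis by (auto simp: form_of_degree_def)
qed

lemma vanishes_at_proj_point:
  assumes "form_of_degree e f" "eval_poly f v = 0"
  shows "vanishes_at f (proj_point v)"
  using assms by (auto simp: vanishes_at_def proj_point_def eval_poly_form_scale)

lemma eval_poly_eq_0_if_vanishes_at:
  assumes "vanishes_at f (proj_point v)"
  shows "eval_poly f v = 0"
proof -
  have "v \<in> proj_point v"
    unfolding proj_point_def by (intro CollectI exI[of _ 1]) simp
  then show ?thesis using assms by (simp add: vanishes_at_def)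
qed

lemma finite_star_points:
  assumes "finite A"
  shows "finite (star_points A)"
proof (rule finite_subset)
  show "star_points A \<subseteq> (\<lambda>(a, b). proj_point (root_point a b)) ` (A \<times> A)"
    by (auto simp: star_points_def)
qed (use assms in simp)

lemma star_points_subset_proj_plane: "star_points A \<subseteq> proj_plane"
  by (auto simp: star_points_def proj_plane_def root_point_nonzero)

lemma star_points_nonempty:
  assumes "card A \<ge> 2"
  shows "star_points A \<noteq> {}"
proof -
  have "\<not> is_singleton A" "A \<noteq> {}" using assms by (auto simp: is_singleton_altdef)
  then obtain a b where "a \<in> A" "b \<in> A" "a \<noteq> b"
    by (meson is_singletonI')
  then show ?thesis by (auto simp: star_points_def)
qed

text \<open>
  At the point with roots \<open>a\<close> and \<open>b\<close>, the factors \<open>line_form a\<close> and \<open>line_form b\<close> of the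
  product already account for vanishing to order two.
\<close>
lemma power_prod_line_form_in_symbolic_power:
  assumes "finite A"
  shows "prod line_form A ^ t \<in> symbolic_power (ideal_of_points (star_points A)) (2 * t)"
  unfolding symbolic_power_ideal_of_points[OF finite_star_points[OF assms]
      star_points_subset_proj_plane]
proof
  fix p assume "p \<in> star_points A"
  then obtain a b where ab: "a \<in> A" "b \<in> A" "a \<noteq> b" "p = proj_point (root_point a b)"
    by (auto simp: star_points_def)
  have "line_form c \<in> ideal_of_points {p}" if "c \<in> {a, b}" for c
  proof -
    have "vanishes_at (line_form c) p"
      unfolding ab using that
      by (intro vanishes_at_proj_point[OF form_of_degree_line_form])
        (auto simp: eval_line_form_root_point)
    then show ?thesis
      unfolding ideal_of_points_def using form_of_degree_line_form
      by (intro ideal.span_base) blast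
  qed
  moreover have "prod line_form A = line_form a * line_form b * prod line_form (A - {a, b})"
  proof -
    have "prod line_form A = line_form a * prod line_form (A - {a})"
      using assms ab by (intro prod.remove)
    also have "prod line_form (A - {a}) = line_form b * prod line_form (A - {a} - {b})"
      using assms ab by (intro prod.remove) auto
    also have "A - {a} - {b} = A - {a, b}" by auto
    finally show ?thesis by (simp only: mult.assoc)
  qed
  ultimately show "prod line_form A ^ t \<in> ideal_power (ideal_of_points {p}) (2 * t)"
    by (simp add: power_mult_in_ideal_power)
qed

text \<open>
  For fixed \<open>s\<close> the points \<open>root_point s t\<close> run through an affine part of the line of \<open>s\<close>.
  If \<open>s\<close> is in \<open>A\<close>, this line carries \<open>card A - 1\<close> of the points, more than the degree.
  So the form vanishes on the lines of all \<open>s\<close> in \<open>A\<close>; the line of any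
  other \<open>s\<close> meets these in \<open>card A\<close> distinct points, again more than the degree.
\<close>
lemma low_degree_form_vanishes:
  fixes f :: "'k::field ternary_poly"
  assumes form: "form_of_degree e f" and e: "e < card A - 1"
    and van: "\<And>p. p \<in> star_points A \<Longrightarrow> vanishes_at f p"
  shows "eval_poly f (root_point s t) = 0"
proof -
  have *: "eval_poly f (root_point a b) = 0"
    if B: "e < card B" and zero: "\<And>c. c \<in> B \<Longrightarrow> eval_poly f (root_point a c) = 0" for a b B
  proof -
    obtain q where q: "\<And>x. poly q x = eval_poly f (root_point a 0 + x *s vector [a, - 1, 0])"
      and deg: "\<And>e. form_of_degree e f \<Longrightarrow> degree q \<le> e"
      using eval_poly_on_line[of f "root_point a 0" "vector [a, - 1, 0]"] by blast
    have val: "poly q x = eval_poly f (root_point a x)" for x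
      unfolding q root_point_affine[of a x] by (rule refl)
    have "q = 0"
    proof (rule poly_eqI_degree[where A = B])
      show "poly q c = poly 0 c" if "c \<in> B" for c
        using zero[OF that] by (simp add: val)
      show "degree q < card B" using deg[OF form] B by simp
      show "degree 0 < card B" using B by simp
    qed
    then show ?thesis using val[of b] by simp
  qed
  have "eval_poly f (root_point a b) = 0" if "a \<in> A" for a b
  proof (rule *)
    have "finite A" using e by (metis card.infinite diff_0_eq_0 not_less_zero)
    then show "e < card (A - {a})" using e that by simp
    show "eval_poly f (root_point a c) = 0" if "c \<in> A - {a}" for c
    proof (rule eval_poly_eq_0_if_vanishes_at, rule van)
      show "proj_point (root_point a c) \<in> star_points A"
        using that \<open>a \<in> A\<close> unfolding star_points_def by blast
    qed
  qed
  then have zero: "eval_poly f (root_point s c) = 0" if "c \<in> A" for c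
    using that by (simp only: root_point_commute[of s])
  show ?thesis
  proof (rule *)
    show "e < card A" using e by simp
  qed (rule zero)
qed

lemma ideal_of_star_points_subset_order_ideal:
  "ideal_of_points (star_points A) \<subseteq> order_ideal (root_point s t) (card A - 1)"
  unfolding ideal_of_points_def
proof (intro ideal.span_minimal subspace_order_ideal subsetI)
  fix f assume "f \<in> {f. (\<exists>d. form_of_degree d f) \<and> (\<forall>p\<in>star_points A. vanishes_at f p)}"
  then obtain e where form: "form_of_degree e f"
    and van: "\<And>p. p \<in> star_points A \<Longrightarrow> vanishes_at f p"
    by blast
  have "eval_poly f (root_point s t) = 0" if "\<not> card A - 1 \<le> e"
    using that van by (intro low_degree_form_vanishes[OF form, of A]) simp_all
  then show "f \<in> order_ideal (root_point s t) (card A - 1)"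
    using form_in_order_ideal[OF form] by blast
qed

text \<open>
  The two powers are compared along the direction of \<open>(X - s)\<^sup>2\<close> for some \<open>s\<close> outside \<open>A\<close>:
  this quadratic has no root in \<open>A\<close>, so it is on none of the lines.
\<close>
lemma symbolic_power_star_points_not_subset:
  fixes A :: "'k::field set"
  assumes "infinite (UNIV :: 'k set)" "finite A" "card A * t < s * (card A - 1)"
  shows "\<not> symbolic_power (ideal_of_points (star_points A)) (2 * t)
    \<subseteq> ideal_power (ideal_of_points (star_points A)) s"
proof
  assume "symbolic_power (ideal_of_points (star_points A)) (2 * t)
    \<subseteq> ideal_power (ideal_of_points (star_points A)) s"
  then have mem: "prod line_form A ^ t \<in> order_ideal (root_point x x) (s * (card A - 1))" for x
    using power_prod_line_form_in_symbolic_power[OF assms(2), of t]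
      ideal_power_subset_order_ideal[OF ideal_of_star_points_subset_order_ideal[of A x x], of s]
    by blast
  obtain x where x: "x \<notin> A" using assms(1,2) ex_new_if_finite by blast
  have "form_of_degree (\<Sum>i<t. \<Sum>a\<in>A. 1) (\<Prod>i<t. prod line_form A)"
    by (intro form_of_degree_prod form_of_degree_line_form)
  then have "form_of_degree (card A * t) (prod line_form A ^ t)"
    by (simp add: mult.commute)
  moreover have "eval_poly (prod line_form A ^ t) (root_point x x) \<noteq> 0"
  proof -
    have "eval_poly (\<Prod>i<t. prod line_form A) (root_point x x) \<noteq> 0"
      using assms(2) x unfolding eval_poly_prod eval_line_form_root_point by auto
    then show ?thesis by simp
  qed
  ultimately have "s * (card A - 1) \<le> card A * t"
    using form_in_order_idealD assms(1) mem by blast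
  then show False using assms(3) by simp
qed

section \<open>The resurgence\<close>

theorem resurgence_star_points_ge:
  fixes A :: "'k::field set"
  assumes "infinite (UNIV :: 'k set)" "finite A" "card A \<ge> 2"
  shows "resurgence (ideal_of_points (star_points A))
    \<ge> ereal (2 * (real (card A) - 1) / real (card A))"
proof -
  define d where "d = card A"
  have d: "d \<ge> 2" using assms(3) by (simp add: d_def)
  let ?c = "2 * (real d - 1) / real d"
  let ?I = "ideal_of_points (star_points A)"
  have bound: "ereal (?c - 2 / real d * inverse (real k)) \<le> resurgence ?I" if k: "k \<ge> 2" for k :: nat
  proof -
    \<comment> \<open>For \<open>s = d * k\<close> this is the largest \<open>t\<close> with \<open>d * t < s * (d - 1)\<close>;
      it is positive since \<open>k \<ge> 2\<close>.\<close>
    define t where "t = (d - 1) * k - 1"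
    have pos: "(d - 1) * k \<ge> 2" using mult_le_mono[of 1 "d - 1" 2 k] d k by simp
    have "d * t < d * ((d - 1) * k)" using d pos by (simp add: t_def)
    then have "card A * t < d * k * (card A - 1)" by (simp add: d_def mult_ac)
    then have "\<not> symbolic_power ?I (2 * t) \<subseteq> ideal_power ?I (d * k)"
      by (rule symbolic_power_star_points_not_subset[OF assms(1,2)])
    moreover have "2 * t > 0" "d * k > 0" using pos d k by (simp_all add: t_def)
    ultimately have "ereal (real (2 * t) / real (d * k)) \<le> resurgence ?I"
      unfolding resurgence_def by (intro Sup_upper) blast
    moreover have "real (2 * t) / real (d * k) = ?c - 2 / real d * inverse (real k)"
    proof -
      have "t + 1 = (d - 1) * k" using pos by (simp add: t_def)
      then have "real t + 1 = real (d - 1) * real k"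
        by (metis of_nat_1 of_nat_add of_nat_mult)
      then have "real t = (real d - 1) * real k - 1" using d by simp
      then have "real (2 * t) / real (d * k)
          = (2 * (real d - 1) * real k - 2) / (real d * real k)"
        by simp
      also have "\<dots> = ?c - 2 / (real d * real k)"
        using k by (simp add: diff_divide_distrib)
      also have "\<dots> = ?c - 2 / real d * inverse (real k)"
        by (simp only: divide_inverse inverse_mult_distrib mult.assoc)
      finally show ?thesis .
    qed
    ultimately show ?thesis by simp
  qed
  have "(\<lambda>k. ?c - 2 / real d * inverse (real k)) \<longlonglongrightarrow> ?c - 2 / real d * 0"
    by (intro tendsto_intros lim_inverse_n)
  then have "(\<lambda>k. ereal (?c - 2 / real d * inverse (real k))) \<longlonglongrightarrow> ereal ?c"
    by (intro tendsto_ereal) simp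
  then have "ereal ?c \<le> resurgence ?I"
    by (rule LIMSEQ_le_const2) (use bound in blast)
  then show ?thesis by (simp add: d_def)
qed

text \<open>Were the field finite, \<open>1 + (\<Prod>a. X - a)\<close> would have no root.\<close>
lemma infinite_alg_closed_field: "infinite (UNIV :: 'k::alg_closed_field set)"
proof
  assume fin: "finite (UNIV :: 'k set)"
  let ?P = "\<Prod>a\<in>(UNIV :: 'k set). [:- a, 1:]"
  have "degree ?P = card (UNIV :: 'k set)"
    by (subst degree_prod_eq_sum_degree) auto
  then have "degree ?P > 0" using fin by (simp add: finite_UNIV_card_ge_0)
  then have "degree (?P + 1) > 0" by (subst degree_add_eq_left) auto
  then obtain x where "poly (?P + 1) x = 0" using alg_closed_imp_poly_has_root by blast
  moreover have "poly ?P x = 0" using fin by (auto simp: poly_prod)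
  ultimately show False by simp
qed

theorem corollary5p2:
  fixes r :: nat
  assumes "r \<ge> 2"
  shows "\<exists>I :: 'k::alg_closed_field ternary_poly set.
    radical_ideal_of_points I \<and> resurgence I \<ge> ereal ((2 * real r - 1) / real r)"
proof -
  obtain A :: "'k set" where A: "finite A" "card A = 2 * r"
    using infinite_arbitrarily_large[OF infinite_alg_closed_field] by blast
  show ?thesis
  proof (intro exI conjI)
    show "radical_ideal_of_points (ideal_of_points (star_points A))"
      unfolding radical_ideal_of_points_def
    proof (intro exI conjI)
      show "star_points A \<noteq> {}" using A(2) assms by (intro star_points_nonempty) simp
    qed (rule finite_star_points[OF A(1)] star_points_subset_proj_plane refl)+
    have "2 * (2 * real r - 1) / (2 * real r) = (2 * real r - 1) / real r"
      by (rule mult_divide_mult_cancel_left) simp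
    then have bound: "2 * (real (card A) - 1) / real (card A) = (2 * real r - 1) / real r"
      by (simp only: A(2) of_nat_mult of_nat_numeral)
    have "card A \<ge> 2" using A(2) assms by simp
    then show "ereal ((2 * real r - 1) / real r)
        \<le> resurgence (ideal_of_points (star_points A))"
      unfolding bound[symmetric]
      by (rule resurgence_star_points_ge[OF infinite_alg_closed_field A(1)])
  qed
qed

end
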